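(* Let $\bm W_{\bm z},\bm W_{\mathcal R},\bm W_{\bm u}^H$ be the weight vectors defined in the context. Then the coarse-level objective $\widetilde\Phi_{H,k}$ is consistent with the fine-level objective $\widetilde\Phi_k$ in the following sense: for all $\bm z_k\in\mathbb{C}^{m^2}$, with $\bm z_{H,k}=\bm I_h^H(\bm W_{\bm z}\odot\bm z_k)$, (1) $\widetilde\Phi_{H,k}(\bm z_{H,k};\bm z_k^{(j)})\le\frac14\|\bm W_{\mathcal R}\|_\infty^2\,\widetilde\Phi_k(\bm z_k;\bm z_k^{(j)})$; (2) $\big\|\nabla_{\bm z_{H,k}}\widetilde\Phi_{H,k}(\bm z_{H,k};\bm z_k^{(j)})\big\|_2\le\frac12\|\bm W_{\bm u}^H\|_\infty\,\big\|\nabla_{\bm z_k}\widetilde\Phi_k(\bm z_k;\bm z_k^{(j)})\big\|_2$.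
   Context: Grids. $m$ is even. Indices of vectors in $\mathbb{C}^{m^2}$ (fine grid) are identified with the points of an $m\times m$ grid, partitioned into $(m/2)^2$ bins $\mathcal B_r$, the $2\times2$ blocks; $r$ indexes vectors in $\mathbb{C}^{(m/2)^2}$ (coarse grid). Restriction: $(\bm I_h^H\bm w)_r=\frac14\sum_{i\in\mathcal B_r}\bm w_i$. Prolongation: $\bm I_H^h=4(\bm I_h^H)^\top$, i.e. $(\bm I_H^h\bm v)_i=\bm v_r$ for $i\in\mathcal B_r$. $\odot,\oslash$ are entrywise product and division; $|\cdot|$, $|\cdot|^2$, $\sqrt\cdot$, $\exp$, $\theta$ (principal argument) act entrywise; $\|\cdot\|_\infty$ is the maximum modulus of the entries. Data. $\bm Q\in\mathbb{C}^{m^2}$ is the probe, assumed to have at least one nonzero entry in each bin; $\bm d_k\in\mathbb{R}^{m^2}$ has nonnegative entries; $\bm z_k^{(j)}\in\mathbb{C}^{m^2}$ is the current ($j$-th) iterate in scanning region $k$; $\mathcal F$ is the two-dimensional discrete Fourier transform on $\mathbb{C}^{m^2}$; $\mathcal R_k(\bm z_k^{(j)})=\mathcal F^{-1}\big(\sqrt{\bm d_k}\odot\exp(i\theta(\mathcal F(\bm Q\odot\bm z_k^{(j)})))\big)\in\mathbb{C}^{m^2}$, where at an index with $[\mathcal F(\bm Q\odot\bm z_k^{(j)})]_r=0$ the angle is $0$ if $j=0$ and otherwise the angle used at the previous iterate. Coarse quantities: $\bm Q_H=\bm I_h^H\bm Q$, $\mathcal R_{H,k}(\bm z_k^{(j)})=\bm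 I_h^H(\bm W_{\mathcal R}\odot\mathcal R_k(\bm z_k^{(j)}))$. Weights: $$\bm W_{\bm z}=|\bm Q|^2\oslash(\bm I_H^h\bm I_h^H|\bm Q|^2),\quad \bm W_{\mathcal R}=(\bm I_H^h\bm Q_H)\odot\bm W_{\bm z}\oslash\bm Q,\quad \bm W_{\bm u}^H=|\bm Q_H|^2\oslash(\bm I_h^H|\bm Q|^2),$$ where $\bm W_{\mathcal R}$ is understood after cancelling $\bm Q$, i.e. $\bm W_{\mathcal R}=(\bm I_H^h\bm Q_H)\odot\overline{\bm Q}\oslash(\bm I_H^h\bm I_h^H|\bm Q|^2)$. Objectives: $\widetilde\Phi_k(\bm z_k;\bm z_k^{(j)})=\frac12\|\bm Q\odot\bm z_k-\mathcal R_k(\bm z_k^{(j)})\|_2^2$ and, for $\bm z_{H,k}\in\mathbb{C}^{(m/2)^2}$, $\widetilde\Phi_{H,k}(\bm z_{H,k};\bm z_k^{(j)})=\frac12\|\bm Q_H\odot\bm z_{H,k}-\mathcal R_{H,k}(\bm z_k^{(j)})\|_2^2$. Gradients are complex gradients with respect to the first argument: for $\bm z=\bm x+i\bm y$, $\nabla_{\bm z}f=\nabla_{\bm x}f+i\nabla_{\bm y}f$. *)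

theory Defs
  imports "HOL-Analysis.Analysis"
begin

text \<open>
  A vector on an \<open>n \<times> n\<close> grid is a total function on pairs of naturals of which only the values
  on \<open>grid n\<close> are relevant: norms, objectives and transforms below only sum (or maximise) over
  \<open>grid n\<close>. The fine grid is \<open>grid m\<close>, the coarse grid is \<open>grid (m div 2)\<close>.
\<close>

type_synonym 'a gvec = "nat \<times> nat \<Rightarrow> 'a"

definition grid :: "nat \<Rightarrow> (nat \<times> nat) set" where
  "grid n = {..<n} \<times> {..<n}"

definition bin :: "nat \<times> nat \<Rightarrow> (nat \<times> nat) set" where
  "bin r = {2 * fst r, 2 * fst r + 1} \<times> {2 * snd r, 2 * snd r + 1}"

definition bin_of :: "nat \<times> nat \<Rightarrow> nat \<times> nat" where
  "bin_of i = (fst i div 2, snd i div 2)"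

lemma in_bin_iff: "i \<in> bin r \<longleftrightarrow> bin_of i = r"
  by (cases i; cases r) (auto simp: bin_def bin_of_def)

lemma card_bin: "card (bin r) = 4"
  by (simp add: bin_def card_cartesian_product)

lemma grid_eq_Union_bins:
  assumes "even m"
  shows "grid m = (\<Union>r\<in>grid (m div 2). bin r)"
  using assms by (auto simp: grid_def in_bin_iff bin_of_def elim!: evenE)

definition vmult :: "complex gvec \<Rightarrow> complex gvec \<Rightarrow> complex gvec" (infixl \<open>\<odot>\<close> 70) where
  "v \<odot> w = (\<lambda>i. v i * w i)"

definition vdivide :: "complex gvec \<Rightarrow> complex gvec \<Rightarrow> complex gvec" (infixl \<open>\<oslash>\<close> 70) where
  "v \<oslash> w = (\<lambda>i. v i / w i)"

definition vabs2 :: "complex gvec \<Rightarrow> complex gvec" where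
  "vabs2 v = (\<lambda>i. of_real ((cmod (v i))\<^sup>2))"

definition vcnj :: "complex gvec \<Rightarrow> complex gvec" where
  "vcnj v = (\<lambda>i. cnj (v i))"

definition norm2 :: "nat \<Rightarrow> complex gvec \<Rightarrow> real" where
  "norm2 n v = sqrt (\<Sum>i\<in>grid n. (cmod (v i))\<^sup>2)"

definition norm_inf :: "nat \<Rightarrow> complex gvec \<Rightarrow> real" where
  "norm_inf n v = Max ((\<lambda>i. cmod (v i)) ` grid n)"

text \<open>Restriction \<open>I\<^sub>h\<^sup>H\<close> and prolongation \<open>I\<^sub>H\<^sup>h\<close>.\<close>

definition restriction :: "complex gvec \<Rightarrow> complex gvec" where
  "restriction w = (\<lambda>r. (1/4) * (\<Sum>i\<in>bin r. w i))"

definition prolongation :: "complex gvec \<Rightarrow> complex gvec" where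
  "prolongation v = (\<lambda>i. v (bin_of i))"

lemma prolongation_on_bin: "i \<in> bin r \<Longrightarrow> prolongation v i = v r"
  by (simp add: prolongation_def in_bin_iff)

text \<open>The factor \<open>1 / n\<^sup>2\<close> is placed in the inverse transform.\<close>

definition dft2 :: "nat \<Rightarrow> complex gvec \<Rightarrow> complex gvec" where
  "dft2 n v = (\<lambda>(p, q). \<Sum>(s, t)\<in>grid n.
     v (s, t) * exp (- (2 * of_real pi * \<i> * of_nat (p * s + q * t) / of_nat n)))"

definition idft2 :: "nat \<Rightarrow> complex gvec \<Rightarrow> complex gvec" where
  "idft2 n w = (\<lambda>(s, t). (1 / of_nat (n\<^sup>2)) * (\<Sum>(p, q)\<in>grid n.
     w (p, q) * exp (2 * of_real pi * \<i> * of_nat (p * s + q * t) / of_nat n)))"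

text \<open>
  \<open>zs j\<close> is the \<open>j\<close>-th iterate in a fixed scanning region. Where the transform vanishes, the angle
  is inherited from the previous iterate, so the angle at step \<open>j\<close> depends on \<open>zs 0, \<dots>, zs j\<close>.
\<close>

primrec phase :: "nat \<Rightarrow> complex gvec \<Rightarrow> (nat \<Rightarrow> complex gvec) \<Rightarrow> nat \<Rightarrow> real gvec" where
  "phase m Q zs 0 = (\<lambda>r. if dft2 m (Q \<odot> zs 0) r = 0 then 0 else Arg (dft2 m (Q \<odot> zs 0) r))"
| "phase m Q zs (Suc j) = (\<lambda>r. if dft2 m (Q \<odot> zs (Suc j)) r = 0 then phase m Q zs j r
                                else Arg (dft2 m (Q \<odot> zs (Suc j)) r))"

definition revised_wave ::
    "nat \<Rightarrow> complex gvec \<Rightarrow> real gvec \<Rightarrow> (nat \<Rightarrow> complex gvec) \<Rightarrow> nat \<Rightarrow> complex gvec" where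
  "revised_wave m Q d zs j =
     idft2 m (\<lambda>r. of_real (sqrt (d r)) * exp (\<i> * of_real (phase m Q zs j r)))"

definition W_z :: "complex gvec \<Rightarrow> complex gvec" where
  "W_z Q = vabs2 Q \<oslash> prolongation (restriction (vabs2 Q))"

text \<open>
  On the support of \<open>Q\<close> this is \<open>prolongation (restriction Q) \<odot> W_z Q \<oslash> Q\<close>; cancelling \<open>Q\<close>
  gives the value at the zeros of \<open>Q\<close>.
\<close>

definition W_R :: "complex gvec \<Rightarrow> complex gvec" where
  "W_R Q = prolongation (restriction Q) \<odot> vcnj Q \<oslash> prolongation (restriction (vabs2 Q))"

lemma W_R_uncancelled:
  "Q i \<noteq> 0 \<Longrightarrow> W_R Q i = (prolongation (restriction Q) \<odot> W_z Q \<oslash> Q) i"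
  by (simp add: W_R_def W_z_def vmult_def vdivide_def vcnj_def vabs2_def complex_norm_square
      del: of_real_power)

definition W_u :: "complex gvec \<Rightarrow> complex gvec" where
  "W_u Q = vabs2 (restriction Q) \<oslash> restriction (vabs2 Q)"

definition revised_wave_H ::
    "nat \<Rightarrow> complex gvec \<Rightarrow> real gvec \<Rightarrow> (nat \<Rightarrow> complex gvec) \<Rightarrow> nat \<Rightarrow> complex gvec" where
  "revised_wave_H m Q d zs j = restriction (W_R Q \<odot> revised_wave m Q d zs j)"

definition Phi ::
    "nat \<Rightarrow> complex gvec \<Rightarrow> real gvec \<Rightarrow> (nat \<Rightarrow> complex gvec) \<Rightarrow> nat \<Rightarrow> complex gvec \<Rightarrow> real" where
  "Phi m Q d zs j z = (1/2) * (norm2 m (\<lambda>i. (Q \<odot> z) i - revised_wave m Q d zs j i))\<^sup>2"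

definition Phi_H ::
    "nat \<Rightarrow> complex gvec \<Rightarrow> real gvec \<Rightarrow> (nat \<Rightarrow> complex gvec) \<Rightarrow> nat \<Rightarrow> complex gvec \<Rightarrow> real" where
  "Phi_H m Q d zs j zH =
     (1/2) * (norm2 (m div 2) (\<lambda>r. (restriction Q \<odot> zH) r - revised_wave_H m Q d zs j r))\<^sup>2"

text \<open>
  \<open>\<nabla>\<^sub>z f = \<nabla>\<^sub>x f + i \<nabla>\<^sub>y f\<close> for \<open>z = x + i y\<close>: entry \<open>l\<close> has the partial derivative of \<open>f\<close> in the
  real part of \<open>z l\<close> as real part, and that in the imaginary part of \<open>z l\<close> as imaginary part.
\<close>

definition cgrad :: "(complex gvec \<Rightarrow> real) \<Rightarrow> complex gvec \<Rightarrow> complex gvec" where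
  "cgrad f z = (\<lambda>l. of_real (deriv (\<lambda>t. f (z(l := Complex t (Im (z l))))) (Re (z l)))
                 + \<i> * of_real (deriv (\<lambda>t. f (z(l := Complex (Re (z l)) t))) (Im (z l))))"

end

theory Submission
  imports Defs
begin

text \<open>
  Both inequalities compare one restricted vector with one fine vector. Let
  \<open>R\<close> be the revised wave, a fixed vector in both objectives, \<open>e = Q \<odot> z - R\<close> the fine
  residual and \<open>Q\<^sub>H\<close> the restriction of \<open>Q\<close>. For \<open>i\<close> in the bin of \<open>r\<close> the weights satisfy
  \<open>Q\<^sub>H r * W_z i = W_R i * Q i\<close>, so the two weights turn the two terms of the coarse residual into
  the two terms of \<open>W_R \<odot> e\<close>: the coarse residual is the restriction of \<open>W_R \<odot> e\<close>
  (\<open>coarse_residual_eq\<close>). The gradient of a weighted least squares objective is the conjugate weight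
  times the residual (\<open>cgrad_least_squares\<close>). Multiplying the coarse residual by \<open>cnj (Q\<^sub>H r)\<close>
  turns the factor \<open>Q\<^sub>H r\<close>, constant on the bin, into \<open>\<bar>Q\<^sub>H r\<bar>\<^sup>2\<close>; what stays under the bin average
  is \<open>cnj Q * e\<close>, the fine gradient. Hence the coarse gradient is \<open>W_u\<close> times the restricted fine
  gradient (\<open>coarse_gradient_eq\<close>).

  Averaging over the four points of a bin halves the Euclidean norm at least, by Cauchy-Schwarz
  (\<open>norm2_restriction_le\<close>), and a weight costs at most its maximum norm (\<open>norm2_vmult_le\<close>).
  For the objective, which is a squared norm, this gives the constant \<open>(1/2)\<^sup>2 = 1/4\<close>; for the
  gradient norm it gives \<open>1/2\<close>.
\<close>

section \<open>Norms on grids and bin averages\<close>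

lemma finite_grid [simp]: "finite (grid n)"
  by (simp add: grid_def)

lemma finite_bin [simp]: "finite (bin r)"
  by (simp add: bin_def)

lemma norm2_nonneg: "0 \<le> norm2 n v"
  by (simp add: norm2_def sum_nonneg)

lemma norm2_power2: "(norm2 n v)\<^sup>2 = (\<Sum>i\<in>grid n. (cmod (v i))\<^sup>2)"
  by (simp add: norm2_def sum_nonneg)

lemma norm2_cong:
  assumes "\<And>i. i \<in> grid n \<Longrightarrow> v i = w i"
  shows "norm2 n v = norm2 n w"
  using assms by (simp add: norm2_def)

lemma norm2_vmult_le: "norm2 n (w \<odot> v) \<le> norm_inf n w * norm2 n v"
proof (cases "grid n = {}")
  case True
  then show ?thesis by (simp add: norm2_def)
next
  case False
  have le: "cmod (w i) \<le> norm_inf n w" if "i \<in> grid n" for i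
    using that by (simp add: norm_inf_def)
  from False obtain i where "i \<in> grid n" by blast
  from le [OF this] have nonneg: "0 \<le> norm_inf n w"
    using norm_ge_zero order_trans by blast
  have "(norm2 n (w \<odot> v))\<^sup>2 = (\<Sum>i\<in>grid n. (cmod (w i))\<^sup>2 * (cmod (v i))\<^sup>2)"
    by (simp add: norm2_power2 vmult_def norm_mult power_mult_distrib)
  also have "\<dots> \<le> (\<Sum>i\<in>grid n. (norm_inf n w)\<^sup>2 * (cmod (v i))\<^sup>2)"
    by (intro sum_mono mult_right_mono power_mono le) auto
  also have "\<dots> = (norm_inf n w * norm2 n v)\<^sup>2"
    by (simp add: norm2_power2 power_mult_distrib sum_distrib_left)
  finally show ?thesis
    by (rule power2_le_imp_le) (simp add: nonneg norm2_nonneg)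
qed

lemma sum_grid_by_bins:
  assumes "even m"
  shows "(\<Sum>i\<in>grid m. g i) = (\<Sum>r\<in>grid (m div 2). \<Sum>i\<in>bin r. g i)"
  unfolding grid_eq_Union_bins [OF assms]
  by (rule sum.UNION_disjoint) (auto simp: in_bin_iff)

text \<open>
  Cauchy-Schwarz on four points bounds the squared modulus of a bin average by \<open>4 / 4\<^sup>2\<close> of the
  sum of squares. Equality holds for vectors constant on bins, so the factor is sharp.
\<close>

lemma norm2_restriction_le:
  assumes "even m"
  shows "norm2 (m div 2) (restriction v) \<le> 1/2 * norm2 m v"
proof -
  have bin_avg: "(cmod (restriction v r))\<^sup>2 \<le> 1/4 * (\<Sum>i\<in>bin r. (cmod (v i))\<^sup>2)" for r
  proof -
    have "(cmod (restriction v r))\<^sup>2 = 1/16 * (cmod (\<Sum>i\<in>bin r. v i))\<^sup>2"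
      by (simp add: restriction_def norm_mult norm_divide power_mult_distrib power_divide)
    also have "\<dots> \<le> 1/16 * (\<Sum>i\<in>bin r. cmod (v i))\<^sup>2"
      by (intro mult_left_mono power_mono norm_sum) auto
    also have "\<dots> \<le> 1/16 * ((\<Sum>i\<in>bin r. (cmod (v i))\<^sup>2) * (\<Sum>i\<in>bin r. 1\<^sup>2))"
      using Cauchy_Schwarz_ineq_sum [of "\<lambda>i. cmod (v i)" "\<lambda>_. 1" "bin r"] by simp
    finally show ?thesis
      by (simp add: card_bin)
  qed
  have "(norm2 (m div 2) (restriction v))\<^sup>2
      \<le> (\<Sum>r\<in>grid (m div 2). 1/4 * (\<Sum>i\<in>bin r. (cmod (v i))\<^sup>2))"
    unfolding norm2_power2 by (intro sum_mono bin_avg)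
  also have "\<dots> = (1/2 * norm2 m v)\<^sup>2"
    by (simp add: power_mult_distrib power_divide norm2_power2 sum_grid_by_bins [OF assms]
        sum_divide_distrib)
  finally show ?thesis
    by (rule power2_le_imp_le) (simp add: norm2_nonneg)
qed

section \<open>Gradient of a weighted least squares objective\<close>

text \<open>
  Only the \<open>l\<close>-th summand depends on \<open>z l\<close>. Its partial derivatives in the real and
  imaginary part of \<open>z l\<close> are the real and imaginary part of the conjugate weight times the
  residual.
\<close>

lemma cgrad_least_squares:
  assumes l: "l \<in> grid n"
  shows "cgrad (\<lambda>v. 1/2 * (norm2 n (\<lambda>i. (a \<odot> v) i - b i))\<^sup>2) z l
    = cnj (a l) * (a l * z l - b l)"
proof -
  define C where "C = (\<Sum>i\<in>grid n - {l}. (cmod (a i * z i - b i))\<^sup>2)"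
  have split: "1/2 * (norm2 n (\<lambda>i. (a \<odot> (z(l := w))) i - b i))\<^sup>2
      = 1/2 * ((Re (a l * w - b l))\<^sup>2 + (Im (a l * w - b l))\<^sup>2 + C)" for w
    unfolding norm2_power2 C_def
    by (subst sum.remove [OF finite_grid l]) (simp add: vmult_def cmod_power2)
  have re: "deriv (\<lambda>t. 1/2 * (norm2 n (\<lambda>i. (a \<odot> (z(l := Complex t (Im (z l))))) i - b i))\<^sup>2)
      (Re (z l)) = Re (cnj (a l) * (a l * z l - b l))"
    unfolding split
    by (rule DERIV_imp_deriv) (auto intro!: derivative_eq_intros simp: field_simps)
  have im: "deriv (\<lambda>t. 1/2 * (norm2 n (\<lambda>i. (a \<odot> (z(l := Complex (Re (z l)) t))) i - b i))\<^sup>2)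
      (Im (z l)) = Im (cnj (a l) * (a l * z l - b l))"
    unfolding split
    by (rule DERIV_imp_deriv) (auto intro!: derivative_eq_intros simp: field_simps)
  show ?thesis
    unfolding cgrad_def re im by (rule complex_eq [symmetric])
qed

section \<open>Coarse residual and coarse gradient as restrictions\<close>

text \<open>
  \<open>Q\<^sub>H\<close> and the bin average of \<open>\<bar>Q\<bar>\<^sup>2\<close> are constant on a bin, so they pass under the bin sum of
  the restriction; there \<open>Q\<^sub>H * \<bar>Q\<bar>\<^sup>2 * z = Q\<^sub>H * cnj Q * (Q * z)\<close>.
\<close>

lemma coarse_residual_eq:
  "restriction Q r * restriction (W_z Q \<odot> z) r - restriction (W_R Q \<odot> R) r
    = restriction (W_R Q \<odot> (\<lambda>i. (Q \<odot> z) i - R i)) r"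
proof -
  have weights: "restriction Q r * (W_z Q i * z i) = W_R Q i * (Q i * z i)" if "i \<in> bin r" for i
    using that
    by (simp add: W_z_def W_R_def vmult_def vdivide_def vcnj_def vabs2_def prolongation_on_bin
        complex_norm_square mult_ac del: of_real_power)
  have "restriction Q r * restriction (W_z Q \<odot> z) r
      = 1/4 * (\<Sum>i\<in>bin r. restriction Q r * (W_z Q i * z i))"
    by (simp add: vmult_def restriction_def [of "\<lambda>i. W_z Q i * z i"] sum_distrib_left)
  also have "\<dots> = 1/4 * (\<Sum>i\<in>bin r. W_R Q i * (Q i * z i))"
    by (simp add: weights)
  finally show ?thesis
    by (simp add: vmult_def restriction_def [of "\<lambda>i. W_R Q i * R i"]
        restriction_def [of "\<lambda>i. W_R Q i * (Q i * z i) - W_R Q i * R i"]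
        right_diff_distrib sum_subtractf diff_divide_distrib)
qed

text \<open>
  The conjugate weight meets the factor \<open>Q\<^sub>H\<close> of \<open>W_R\<close>; their product over the bin average of
  \<open>\<bar>Q\<bar>\<^sup>2\<close> is \<open>W_u\<close>, constant on the bin, and the factor \<open>cnj Q\<close> of \<open>W_R\<close> remains inside.
\<close>

lemma coarse_gradient_eq:
  "cnj (restriction Q r) * restriction (W_R Q \<odot> e) r
    = (W_u Q \<odot> restriction (vcnj Q \<odot> e)) r"
proof -
  have weights: "cnj (restriction Q r) * (W_R Q i * e i) = W_u Q r * (cnj (Q i) * e i)"
    if "i \<in> bin r" for i
    using that
    by (simp add: W_R_def W_u_def vmult_def vdivide_def vcnj_def prolongation_on_bin
        vabs2_def [of "restriction Q"] complex_norm_square mult_ac del: of_real_power)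
  have "cnj (restriction Q r) * restriction (W_R Q \<odot> e) r
      = 1/4 * (\<Sum>i\<in>bin r. cnj (restriction Q r) * (W_R Q i * e i))"
    by (simp add: vmult_def restriction_def [of "\<lambda>i. W_R Q i * e i"] sum_distrib_left)
  also have "\<dots> = 1/4 * (\<Sum>i\<in>bin r. W_u Q r * (cnj (Q i) * e i))"
    by (simp add: weights)
  finally show ?thesis
    by (simp add: vmult_def vcnj_def restriction_def [of "\<lambda>i. cnj (Q i) * e i"] sum_distrib_left)
qed

section \<open>Consistency of the two levels\<close>

theorem proposition4p2:
  fixes m :: nat
    and Q :: "complex gvec"
    and d :: "nat \<Rightarrow> real gvec"
    and zs :: "nat \<Rightarrow> nat \<Rightarrow> complex gvec"
    and k j :: nat
  assumes "even m"
    and "\<And>r. r \<in> grid (m div 2) \<Longrightarrow> \<exists>i\<in>bin r. Q i \<noteq> 0"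
    and "\<And>i. i \<in> grid m \<Longrightarrow> 0 \<le> d k i"
  shows "\<forall>z :: complex gvec.
     Phi_H m Q (d k) (zs k) j (restriction (W_z Q \<odot> z))
       \<le> 1/4 * (norm_inf m (W_R Q))\<^sup>2 * Phi m Q (d k) (zs k) j z \<and>
     norm2 (m div 2) (cgrad (Phi_H m Q (d k) (zs k) j) (restriction (W_z Q \<odot> z)))
       \<le> 1/2 * norm_inf (m div 2) (W_u Q) * norm2 m (cgrad (Phi m Q (d k) (zs k) j) z)"
proof (intro allI conjI)
  fix z :: "complex gvec"
  define R where "R = revised_wave m Q (d k) (zs k) j"
  define e where "e = (\<lambda>i. (Q \<odot> z) i - R i)"
  let ?zH = "restriction (W_z Q \<odot> z)"
  have residual: "restriction Q r * ?zH r - revised_wave_H m Q (d k) (zs k) j r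
      = restriction (W_R Q \<odot> e) r" for r
    by (simp add: revised_wave_H_def coarse_residual_eq e_def R_def)

  have "norm2 (m div 2) (restriction (W_R Q \<odot> e)) \<le> 1/2 * norm2 m (W_R Q \<odot> e)"
    by (rule norm2_restriction_le [OF \<open>even m\<close>])
  also have "\<dots> \<le> 1/2 * (norm_inf m (W_R Q) * norm2 m e)"
    using norm2_vmult_le by simp
  finally have "(norm2 (m div 2) (restriction (W_R Q \<odot> e)))\<^sup>2
      \<le> (1/2 * (norm_inf m (W_R Q) * norm2 m e))\<^sup>2"
    by (rule power_mono) (rule norm2_nonneg)
  then have bound: "(norm2 (m div 2) (restriction (W_R Q \<odot> e)))\<^sup>2
      \<le> 1/4 * (norm_inf m (W_R Q))\<^sup>2 * (norm2 m e)\<^sup>2"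
    by (simp add: power_mult_distrib power_divide)
  have "Phi_H m Q (d k) (zs k) j ?zH
      = 1/2 * (norm2 (m div 2) (restriction (W_R Q \<odot> e)))\<^sup>2"
    by (simp add: Phi_H_def vmult_def [of "restriction Q"] residual)
  also have "\<dots> \<le> 1/2 * (1/4 * (norm_inf m (W_R Q))\<^sup>2 * (norm2 m e)\<^sup>2)"
    using bound by (rule mult_left_mono) simp
  also have "\<dots> = 1/4 * (norm_inf m (W_R Q))\<^sup>2 * Phi m Q (d k) (zs k) j z"
    by (simp add: Phi_def e_def R_def)
  finally show "Phi_H m Q (d k) (zs k) j ?zH
      \<le> 1/4 * (norm_inf m (W_R Q))\<^sup>2 * Phi m Q (d k) (zs k) j z" .

  have "cgrad (Phi m Q (d k) (zs k) j) z i = (vcnj Q \<odot> e) i" if "i \<in> grid m" for i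
    using cgrad_least_squares [OF that, of Q R z]
    by (simp add: Phi_def [abs_def] e_def R_def vmult_def vcnj_def)
  then have fine: "norm2 m (cgrad (Phi m Q (d k) (zs k) j) z) = norm2 m (vcnj Q \<odot> e)"
    by (rule norm2_cong)
  have "cgrad (Phi_H m Q (d k) (zs k) j) ?zH r = (W_u Q \<odot> restriction (vcnj Q \<odot> e)) r"
    if "r \<in> grid (m div 2)" for r
    unfolding Phi_H_def [abs_def] cgrad_least_squares [OF that] residual
    by (rule coarse_gradient_eq)
  then have coarse: "norm2 (m div 2) (cgrad (Phi_H m Q (d k) (zs k) j) ?zH)
      = norm2 (m div 2) (W_u Q \<odot> restriction (vcnj Q \<odot> e))"
    by (rule norm2_cong)
  show "norm2 (m div 2) (cgrad (Phi_H m Q (d k) (zs k) j) ?zH)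
      \<le> 1/2 * norm_inf (m div 2) (W_u Q) * norm2 m (cgrad (Phi m Q (d k) (zs k) j) z)"
  proof (cases "m = 0")
    case True
    then show ?thesis by (simp add: norm2_def grid_def)
  next
    (* The sign of norm_inf is only known on a nonempty grid, where it is a maximum of moduli. *)
    case False
    with \<open>even m\<close> have "(0, 0) \<in> grid (m div 2)"
      by (auto simp: grid_def elim!: evenE)
    then have "cmod (W_u Q (0, 0)) \<le> norm_inf (m div 2) (W_u Q)"
      by (simp add: norm_inf_def)
    then have nonneg: "0 \<le> norm_inf (m div 2) (W_u Q)"
      using norm_ge_zero order_trans by blast
    have "norm2 (m div 2) (W_u Q \<odot> restriction (vcnj Q \<odot> e))
        \<le> norm_inf (m div 2) (W_u Q) * norm2 (m div 2) (restriction (vcnj Q \<odot> e))"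
      by (rule norm2_vmult_le)
    also have "\<dots> \<le> norm_inf (m div 2) (W_u Q) * (1/2 * norm2 m (vcnj Q \<odot> e))"
      by (intro mult_left_mono norm2_restriction_le \<open>even m\<close> nonneg)
    finally show ?thesis
      by (simp add: coarse fine)
  qed
qed

end
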